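(* In the risk model with interest rate described in the context, suppose that $$e^{-r(t)}R(t)\ge u-Y(t)\quad\text{for all }t>0,\qquad Y(t):=\int_0^te^{-r(x)}\,dS(x),$$ where $Y(t)$, $t\ge0$, is a separable process with independent increments, and that for all $h\ge0$, $t\ge 0$, $$\mathbf{E}e^{hY(t)}=e^{a(h,t)},\qquad a(h,t):=-h\int_0^te^{-r(x)}\,dp(x)+\int_0^tQ(he^{-r(x)},x)\,d\Lambda(x),$$ where $Q(h,x):=\mathbf{E}e^{hZ(x)}-1$. Then $$\psi(u)\le e^{-L^*u}\quad\text{for all }u\ge 0,\qquad\text{where}\quad L^*=\sup\Big\{h\ge 0:\sup_{t\ge 0}a(h,t)\le 0\Big\}.$$
   Context: Model B: $N(t)$, $t\ge 0$, is a non-homogeneous Poisson process with non-decreasing accumulated intensity function $\Lambda(t)=\mathbf{E}N(t)<\infty$, $N(0)=\Lambda(0)=0$, with claim times $T_j=\min\{t\ge 0:N(t)\ge j\}$. $Z(t)\ge 0$ denotes the claim size in case a claim arrives at time $t$; $N(\cdot)$ and $Z(\cdot)$ are independent, and the $Z(T_j)$, $j\ge1$, are independent but not necessarily identically distributed. $p(t)\ge 0$ is the non-decreasing aggregate premium income over $[0,t]$, and $q(t)$ is the total claim amount over $[0,t]$ (the principal case being $q(t)=\sum_{j=1}^{N(t)}Z(T_j)$). The risk reserve process $R$, with initial reserve $R(0)=u$, satisfies for all $t_2>t_1\ge 0$ $$R(t_2)=(1+\alpha(t_1,t_2))R(t_1)+(1+\beta(t_1,t_2))[p(t_2)-p(t_1)]-[q(t_2)-q(t_1)],$$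 where the interest rates satisfy $\beta(t_1,t_2)\ge 0$ and $1+\alpha(t_1,t_2)\ge e^{r(t_2)-r(t_1)}$ for a non-random non-decreasing function $r$ with $r(0)=0$. Put $S(t)=q(t)-p(t)$, assumed of bounded variation on finite intervals, so that $Y$ is defined pathwise and $Y(0)=0$. The ultimate ruin probability is $\psi(u)=\mathbf{P}(\inf_{t\ge 0}R(t)<0)$. Separable is meant in Doob's sense. Exponential moments may be $+\infty$, with $e^{+\infty}=+\infty$. If $L^*=\infty$, then $e^{-L^*u}$ is read as $0$ for $u>0$ and $1$ for $u=0$. *)

theory Defs
  imports "HOL-Probability.Probability"
begin

section \<open>Lebesgue--Stieltjes integration over a compact interval\<close>

text \<open>
  The integrators below are not assumed right-continuous, whereas \<^const>\<open>interval_measure\<close>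
  is only meaningful for right-continuous monotone functions.  We therefore freeze \<open>F\<close> outside
  \<open>[a, b]\<close> and pass to right limits inside.  For nondecreasing \<open>F\<close> the resulting measure
  has atoms \<open>F(a+) - F(a)\<close> at \<open>a\<close>, \<open>F(x+) - F(x-)\<close> at inner points \<open>x\<close> and
  \<open>F(b) - F(b-)\<close> at \<open>b\<close>, hence total mass \<open>F(b) - F(a)\<close>.  If \<open>F\<close> is right-continuous,
  it is the usual Lebesgue--Stieltjes measure restricted to \<open>(a, b]\<close>.
\<close>

definition stieltjes_measure :: "(real \<Rightarrow> real) \<Rightarrow> real \<Rightarrow> real \<Rightarrow> real measure" where
  "stieltjes_measure F a b =
     interval_measure (\<lambda>x. if x < a then F a else if b \<le> x then F b else Inf (F ` {x<..b}))"

definition variation_sums :: "(real \<Rightarrow> real) \<Rightarrow> real \<Rightarrow> real \<Rightarrow> real set" where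
  "variation_sums F a b =
     {(\<Sum>i<n. \<bar>F (x (Suc i)) - F (x i)\<bar>) | (n::nat) x.
        a \<le> x 0 \<and> (\<forall>i<n. x i \<le> x (Suc i)) \<and> x n \<le> b}"

definition bounded_variation :: "(real \<Rightarrow> real) \<Rightarrow> real \<Rightarrow> real \<Rightarrow> bool" where
  "bounded_variation F a b \<longleftrightarrow> bdd_above (variation_sums F a b)"

definition total_variation :: "(real \<Rightarrow> real) \<Rightarrow> real \<Rightarrow> real \<Rightarrow> real" where
  "total_variation F a b = Sup (variation_sums F a b)"

definition stieltjes_integral :: "(real \<Rightarrow> real) \<Rightarrow> (real \<Rightarrow> real) \<Rightarrow> real \<Rightarrow> real \<Rightarrow> real" where
  "stieltjes_integral f F a b = (LINT x:{a..b}|stieltjes_measure F a b. f x)"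

text \<open>For an integrator \<open>F\<close> of bounded variation, write \<open>F = V - (V - F)\<close> with \<open>V\<close> its
  variation function; both \<open>V\<close> and \<open>V - F\<close> are nondecreasing.\<close>

definition bv_stieltjes_integral ::
    "(real \<Rightarrow> real) \<Rightarrow> (real \<Rightarrow> real) \<Rightarrow> real \<Rightarrow> real \<Rightarrow> real" where
  "bv_stieltjes_integral f F a b =
     stieltjes_integral f (\<lambda>x. total_variation F a x) a b
     - stieltjes_integral f (\<lambda>x. total_variation F a x - F x) a b"

section \<open>Processes\<close>

definition independent_increments :: "'a measure \<Rightarrow> (real \<Rightarrow> 'a \<Rightarrow> real) \<Rightarrow> bool" where
  "independent_increments M X \<longleftrightarrow>
     (\<forall>(n::nat) t. 0 \<le> t 0 \<and> (\<forall>i<n. t i < t (Suc i)) \<longrightarrow>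
        prob_space.indep_vars M (\<lambda>_. borel) (\<lambda>i \<omega>. X (t (Suc i)) \<omega> - X (t i) \<omega>) {..<n})"

text \<open>Separability in Doob's sense, relative to the class of (possibly infinite) closed
  intervals, of a process with parameter set \<open>[0, \<infinity>)\<close>.\<close>

definition separable_process :: "'a measure \<Rightarrow> (real \<Rightarrow> 'a \<Rightarrow> real) \<Rightarrow> bool" where
  "separable_process M X \<longleftrightarrow>
     (\<exists>D \<Theta>. countable D \<and> D \<subseteq> {0..} \<and> \<Theta> \<in> null_sets M \<and>
        (\<forall>I A. open I \<and> is_interval I \<and> closed A \<and> is_interval A \<longrightarrow>
           (\<forall>\<omega>\<in>space M - \<Theta>. (\<forall>t\<in>I \<inter> {0..}. X t \<omega> \<in> A) \<longleftrightarrow> (\<forall>t\<in>I \<inter> D. X t \<omega> \<in> A))))"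

text \<open>The time of the \<open>j\<close>-th claim; it is \<open>\<infinity>\<close> if there are fewer than \<open>j\<close> claims.  For
  right-continuous paths the infimum is a minimum.\<close>

definition claim_time :: "(real \<Rightarrow> 'a \<Rightarrow> nat) \<Rightarrow> nat \<Rightarrow> 'a \<Rightarrow> ereal" where
  "claim_time N j \<omega> = (INF t\<in>{t. 0 \<le> t \<and> j \<le> N t \<omega>}. ereal t)"

definition nonhomogeneous_poisson_process ::
    "'a measure \<Rightarrow> (real \<Rightarrow> 'a \<Rightarrow> nat) \<Rightarrow> (real \<Rightarrow> real) \<Rightarrow> bool" where
  "nonhomogeneous_poisson_process M N \<Lambda> \<longleftrightarrow>
     (\<forall>t\<ge>0. N t \<in> measurable M (count_space UNIV)) \<and>
     (\<forall>\<omega>\<in>space M. N 0 \<omega> = 0 \<and> mono_on {0..} (\<lambda>t. N t \<omega>) \<and>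
        (\<forall>t\<ge>0. continuous (at_right t) (\<lambda>s. real (N s \<omega>)))) \<and>
     mono_on {0..} \<Lambda> \<and>
     (\<forall>t\<ge>0. integrable M (\<lambda>\<omega>. real (N t \<omega>)) \<and> \<Lambda> t = (\<integral>\<omega>. real (N t \<omega>) \<partial>M)) \<and>
     independent_increments M (\<lambda>t \<omega>. real (N t \<omega>)) \<and>
     (\<forall>s t k. 0 \<le> s \<and> s \<le> t \<longrightarrow>
        measure M {\<omega>\<in>space M. N t \<omega> = N s \<omega> + k} =
          (\<Lambda> t - \<Lambda> s) ^ k / fact k * exp (- (\<Lambda> t - \<Lambda> s)))"

section \<open>The risk model with interest\<close>

text \<open>The claim sizes \<open>Z(T\<^sub>j)\<close> only make sense on \<open>{T\<^sub>j < \<infinity>}\<close>.  The variables \<open>\<zeta> j\<close> in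
  \<open>claim_sizes\<close> extend them to the whole space, with arbitrary values where \<open>T\<^sub>j = \<infinity>\<close>.
  The total claim amount \<open>q\<close> is a primitive of the model.\<close>

locale risk_model = prob_space M
  for M :: "'a measure" +
  fixes N :: "real \<Rightarrow> 'a \<Rightarrow> nat"
    and \<Lambda> :: "real \<Rightarrow> real"
    and Z :: "real \<Rightarrow> 'a \<Rightarrow> real"
    and p :: "real \<Rightarrow> real"
    and q :: "real \<Rightarrow> 'a \<Rightarrow> real"
    and r :: "real \<Rightarrow> real"
    and \<alpha> \<beta> :: "real \<Rightarrow> real \<Rightarrow> 'a \<Rightarrow> real"
    and R :: "real \<Rightarrow> 'a \<Rightarrow> real"
    and u :: real
  assumes claim_arrivals: "nonhomogeneous_poisson_process M N \<Lambda>"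
    and claim_size_measurable: "\<And>t. 0 \<le> t \<Longrightarrow> random_variable borel (Z t)"
    and claim_size_nonneg: "\<And>t \<omega>. 0 \<le> t \<Longrightarrow> \<omega> \<in> space M \<Longrightarrow> 0 \<le> Z t \<omega>"
    and arrivals_sizes_indep:
      "indep_var (\<Pi>\<^sub>M t\<in>{0..}. count_space UNIV) (\<lambda>\<omega>. \<lambda>t\<in>{0..}. N t \<omega>)
                 (\<Pi>\<^sub>M t\<in>{0..}. borel) (\<lambda>\<omega>. \<lambda>t\<in>{0..}. Z t \<omega>)"
    and claim_sizes:
      "\<exists>\<zeta>. indep_vars (\<lambda>_. borel) \<zeta> {1::nat..} \<and>
           (\<forall>j\<ge>1. \<forall>\<omega>\<in>space M. \<forall>t. claim_time N j \<omega> = ereal t \<longrightarrow> \<zeta> j \<omega> = Z t \<omega>)"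
    and premium_nonneg: "\<And>t. 0 \<le> t \<Longrightarrow> 0 \<le> p t"
    and premium_mono: "mono_on {0..} p"
    and claims_measurable: "\<And>t. 0 \<le> t \<Longrightarrow> random_variable borel (q t)"
    and loss_bv: "\<And>t \<omega>. 0 \<le> t \<Longrightarrow> \<omega> \<in> space M \<Longrightarrow> bounded_variation (\<lambda>x. q x \<omega> - p x) 0 t"
    and rate_mono: "mono_on {0..} r"
    and rate_zero: "r 0 = 0"
    and premium_interest:
      "\<And>s t \<omega>. 0 \<le> s \<Longrightarrow> s < t \<Longrightarrow> \<omega> \<in> space M \<Longrightarrow> 0 \<le> \<beta> s t \<omega>"
    and reserve_interest:
      "\<And>s t \<omega>. 0 \<le> s \<Longrightarrow> s < t \<Longrightarrow> \<omega> \<in> space M \<Longrightarrow> exp (r t - r s) \<le> 1 + \<alpha> s t \<omega>"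
    and reserve_measurable: "\<And>t. 0 \<le> t \<Longrightarrow> random_variable borel (R t)"
    and reserve_zero: "\<And>\<omega>. \<omega> \<in> space M \<Longrightarrow> R 0 \<omega> = u"
    and reserve_step:
      "\<And>s t \<omega>. 0 \<le> s \<Longrightarrow> s < t \<Longrightarrow> \<omega> \<in> space M \<Longrightarrow>
         R t \<omega> = (1 + \<alpha> s t \<omega>) * R s \<omega> + (1 + \<beta> s t \<omega>) * (p t - p s) - (q t \<omega> - q s \<omega>)"
    and ruin_event: "{\<omega>\<in>space M. (INF t\<in>{0..}. ereal (R t \<omega>)) < 0} \<in> events"

definition ruin_probability :: "'a measure \<Rightarrow> (real \<Rightarrow> 'a \<Rightarrow> real) \<Rightarrow> real" where
  "ruin_probability M R = measure M {\<omega>\<in>space M. (INF t\<in>{0..}. ereal (R t \<omega>)) < 0}"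

text \<open>The process \<open>Y(t) = \<integral>\<^sub>0\<^sup>t e\<^sup>-\<^sup>r\<^sup>(\<^sup>x\<^sup>) dS(x)\<close> with \<open>S = q - p\<close>.\<close>

definition discounted_loss ::
    "(real \<Rightarrow> real) \<Rightarrow> (real \<Rightarrow> 'a \<Rightarrow> real) \<Rightarrow> (real \<Rightarrow> real) \<Rightarrow> real \<Rightarrow> 'a \<Rightarrow> real" where
  "discounted_loss p q r t \<omega> =
     bv_stieltjes_integral (\<lambda>x. exp (- r x)) (\<lambda>x. q x \<omega> - p x) 0 t"

text \<open>For \<open>h \<ge> 0\<close> and nonnegative claim sizes the expectation below is at least \<open>1\<close>, so the
  subtraction in \<^typ>\<open>ennreal\<close> is not truncated.\<close>

definition claim_exponent :: "'a measure \<Rightarrow> (real \<Rightarrow> 'a \<Rightarrow> real) \<Rightarrow> real \<Rightarrow> real \<Rightarrow> ennreal" where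
  "claim_exponent M Z h x = (\<integral>\<^sup>+ \<omega>. ennreal (exp (h * Z x \<omega>)) \<partial>M) - 1"

definition cumulant ::
    "'a measure \<Rightarrow> (real \<Rightarrow> real) \<Rightarrow> (real \<Rightarrow> 'a \<Rightarrow> real) \<Rightarrow> (real \<Rightarrow> real) \<Rightarrow> (real \<Rightarrow> real)
       \<Rightarrow> real \<Rightarrow> real \<Rightarrow> ereal" where
  "cumulant M \<Lambda> Z p r h t =
     ereal (- h * stieltjes_integral (\<lambda>x. exp (- r x)) p 0 t)
     + enn2ereal (\<integral>\<^sup>+x\<in>{0..t}. claim_exponent M Z (h * exp (- r x)) x \<partial>stieltjes_measure \<Lambda> 0 t)"

definition adjustment_coefficient ::
    "'a measure \<Rightarrow> (real \<Rightarrow> real) \<Rightarrow> (real \<Rightarrow> 'a \<Rightarrow> real) \<Rightarrow> (real \<Rightarrow> real) \<Rightarrow> (real \<Rightarrow> real)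
       \<Rightarrow> ereal" where
  "adjustment_coefficient M \<Lambda> Z p r =
     Sup (ereal ` {h. 0 \<le> h \<and> (SUP t\<in>{0..}. cumulant M \<Lambda> Z p r h t) \<le> 0})"

text \<open>With \<open>\<infinity> * 0 = 0\<close> in \<^typ>\<open>ereal\<close>, \<open>ereal_exp (- (\<infinity> * u))\<close> is \<open>1\<close> for \<open>u = 0\<close> and
  \<open>0\<close> for \<open>u > 0\<close>.\<close>

definition ereal_exp :: "ereal \<Rightarrow> ennreal" where
  "ereal_exp x = (if x = \<infinity> then \<infinity> else if x = -\<infinity> then 0 else ennreal (exp (real_of_ereal x)))"

end

theory Submission
  imports Defs
begin

text \<open>
  Let \<open>h \<ge> 0\<close> satisfy \<open>sup\<^sub>t a(h, t) \<le> 0\<close>.  As \<open>Y\<close> has independent increments,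
  \<open>exp (h Y(t) - a(h, t))\<close> is a positive martingale started at \<open>1\<close>, and it is at least
  \<open>exp (h u)\<close> whenever \<open>Y(t) > u\<close>.  Stopping it at the first passage above \<open>u\<close> along a
  finite set of times bounds the passage probability by \<open>exp (- h u)\<close>; separability extends
  this to all times.  Ruin forces \<open>Y\<close> above \<open>u\<close>, and it remains to optimise over \<open>h\<close>.
\<close>

section \<open>Maximal inequality for independent increments\<close>

lemma (in prob_space) indep_var_nn_integral_mult:
  fixes f g :: "'b \<Rightarrow> ennreal"
  assumes indep: "indep_var S X T Y"
    and f[measurable]: "f \<in> borel_measurable S" and g[measurable]: "g \<in> borel_measurable T"
  shows "(\<integral>\<^sup>+\<omega>. f (X \<omega>) * g (Y \<omega>) \<partial>M) = (\<integral>\<^sup>+\<omega>. f (X \<omega>) \<partial>M) * (\<integral>\<^sup>+\<omega>. g (Y \<omega>) \<partial>M)"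
proof -
  have [measurable]: "X \<in> measurable M S" "Y \<in> measurable M T"
    and eq: "distr M S X \<Otimes>\<^sub>M distr M T Y = distr M (S \<Otimes>\<^sub>M T) (\<lambda>x. (X x, Y x))"
    using indep by (auto simp: indep_var_distribution_eq)
  interpret D: prob_space "distr M T Y" by (rule prob_space_distr) simp
  \<comment> \<open>Independence makes the joint law a product measure, so Tonelli applies. Values
    in \<open>ennreal\<close> avoid any integrability condition.\<close>
  have "(\<integral>\<^sup>+\<omega>. f (X \<omega>) * g (Y \<omega>) \<partial>M)
      = (\<integral>\<^sup>+z. f (fst z) * g (snd z) \<partial>distr M (S \<Otimes>\<^sub>M T) (\<lambda>x. (X x, Y x)))"
    by (subst nn_integral_distr) auto
  also have "\<dots> = (\<integral>\<^sup>+x. \<integral>\<^sup>+y. f x * g y \<partial>distr M T Y \<partial>distr M S X)"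
    unfolding eq[symmetric] by (subst D.nn_integral_fst[symmetric]) auto
  also have "\<dots> = (\<integral>\<^sup>+\<omega>. f (X \<omega>) \<partial>M) * (\<integral>\<^sup>+\<omega>. g (Y \<omega>) \<partial>M)"
    by (simp add: nn_integral_cmult nn_integral_multc nn_integral_distr)
  finally show ?thesis .
qed

text \<open>The martingale \<open>exp (h * S k - a k)\<close>, replaced from the first passage above
  \<open>u\<close> on by the constant \<open>exp (h * u)\<close>, is a supermartingale with initial
  mean at most 1. Markov's inequality at time \<open>n\<close> then bounds the passage
  probability.\<close>

lemma (in prob_space) maximal_inequality_indep_sums:
  fixes X :: "nat \<Rightarrow> 'a \<Rightarrow> real" and a :: "nat \<Rightarrow> real"
  assumes indep: "indep_vars (\<lambda>_. borel) X {..<n}"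
    and "0 \<le> h"
    and mgf: "\<And>k. k \<le> n \<Longrightarrow>
      (\<integral>\<^sup>+\<omega>. ennreal (exp (h * (\<Sum>i<k. X i \<omega>))) \<partial>M) = ennreal (exp (a k))"
    and nonpos: "\<And>k. k \<le> n \<Longrightarrow> a k \<le> 0"
  shows "emeasure M {\<omega>\<in>space M. \<exists>k\<le>n. u < (\<Sum>i<k. X i \<omega>)} \<le> ennreal (exp (- (h * u)))"
proof -
  define S where "S k \<omega> = (\<Sum>i<k. X i \<omega>)" for k \<omega>
  \<comment> \<open>Freezing at \<open>exp (h * u)\<close> instead of at the value reached discards
    the overshoot, so no passage time has to be named.\<close>
  define V where "V k \<omega> = (if \<exists>j\<le>k. u < S j \<omega> then ennreal (exp (h * u))
    else ennreal (exp (h * S k \<omega> - a k)))" for k \<omega>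
  have X[measurable]: "X i \<in> borel_measurable M" if "i < n" for i
    using indep that by (auto simp: indep_vars_def)
  have S[measurable]: "S k \<in> borel_measurable M" if "k \<le> n" for k
    unfolding S_def[abs_def] using that by (intro borel_measurable_sum X) auto
  have "(\<integral>\<^sup>+\<omega>. V k \<omega> \<partial>M) \<le> 1" if "k \<le> n" for k
    using that
  proof (induction k)
    case 0
    \<comment> \<open>The empty sum has exponential moment 1, which forces
      \<open>a 0 = 0\<close>.\<close>
    have "ennreal 1 = ennreal (exp (a 0))"
      using mgf[of 0] by (simp add: emeasure_space_1)
    then have a0: "a 0 = 0"
      by (subst (asm) ennreal_inj) auto
    have "V 0 \<omega> \<le> 1" for \<omega>
      using \<open>0 \<le> h\<close> by (auto simp: V_def S_def a0 mult_nonneg_nonpos)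
    then have "(\<integral>\<^sup>+\<omega>. V 0 \<omega> \<partial>M) \<le> (\<integral>\<^sup>+\<omega>. 1 \<partial>M)"
      by (intro nn_integral_mono)
    then show ?case by (simp add: emeasure_space_1)
  next
    case (Suc k)
    then have k: "k < n" by simp
    note [measurable] = X[OF k]
    have S_k[measurable]: "S j \<in> borel_measurable M" if "j \<le> k" for j
      using that k by (intro S) auto
    \<comment> \<open>The past is the whole vector of the first \<open>k\<close> summands, since the
      event of earlier passage depends on all of them. The present is the singleton block
      \<open>{k}\<close>.\<close>
    have past: "indep_var (PiM {..<k} (\<lambda>_. borel)) (\<lambda>\<omega>. restrict (\<lambda>i. X i \<omega>) {..<k})
        (PiM {k} (\<lambda>_. borel)) (\<lambda>\<omega>. restrict (\<lambda>i. X i \<omega>) {k})"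
      using k by (intro indep_var_restrict[OF indep]) auto
    have split: "(\<integral>\<^sup>+\<omega>. F (restrict (\<lambda>i. X i \<omega>) {..<k}) * g (X k \<omega>) \<partial>M)
        = (\<integral>\<^sup>+\<omega>. F (restrict (\<lambda>i. X i \<omega>) {..<k}) \<partial>M) * (\<integral>\<^sup>+\<omega>. g (X k \<omega>) \<partial>M)"
      if [measurable]: "F \<in> borel_measurable (PiM {..<k} (\<lambda>_. borel))" "g \<in> borel_measurable borel"
      for F :: "(nat \<Rightarrow> real) \<Rightarrow> ennreal" and g
      using indep_var_nn_integral_mult[OF past, of F "\<lambda>x. g (x k)"] by simp
    define s where "s j x = (\<Sum>i<j. x i)" for j and x :: "nat \<Rightarrow> real"
    have s: "s j \<in> borel_measurable (PiM {..<k} (\<lambda>_. borel))" if "j \<le> k" for j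
      unfolding s_def[abs_def] using that by (intro borel_measurable_sum) auto
    have s_S: "s j (restrict (\<lambda>i. X i \<omega>) {..<k}) = S j \<omega>" if "j \<le> k" for j \<omega>
      using that by (auto simp: s_def S_def intro!: sum.cong)
    \<comment> \<open>The factor by which the martingale changes from \<open>k\<close> to
      \<open>Suc k\<close>.\<close>
    define g where "g x = ennreal (exp (h * x - (a (Suc k) - a k)))" for x
    have [measurable]: "g \<in> borel_measurable borel"
      unfolding g_def[abs_def] by measurable
    have S_Suc: "S (Suc k) \<omega> = S k \<omega> + X k \<omega>" for \<omega>
      by (simp add: S_def)
    \<comment> \<open>The moment of a single summand is recovered from those of the partial sums:
      the martingale has mean 1 at both \<open>k\<close> and \<open>Suc k\<close>, and independence
      factors the latter mean as the former times that of \<open>g\<close>.\<close>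
    have g_int: "(\<integral>\<^sup>+\<omega>. g (X k \<omega>) \<partial>M) = 1"
    proof -
      have "(\<integral>\<^sup>+\<omega>. ennreal (exp (h * S k \<omega> - a k)) \<partial>M)
          = (\<integral>\<^sup>+\<omega>. ennreal (exp (- a k)) * ennreal (exp (h * S k \<omega>)) \<partial>M)"
        by (simp add: ennreal_mult'[symmetric] exp_add[symmetric] algebra_simps)
      also have "\<dots> = 1"
        using mgf[of k] k
        by (subst nn_integral_cmult) (auto simp: S_def[symmetric] ennreal_mult'[symmetric] exp_add[symmetric])
      finally have 1: "(\<integral>\<^sup>+\<omega>. ennreal (exp (h * S k \<omega> - a k)) \<partial>M) = 1" .
      have "1 = (\<integral>\<^sup>+\<omega>. ennreal (exp (- a (Suc k))) * ennreal (exp (h * S (Suc k) \<omega>)) \<partial>M)"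
        using mgf[of "Suc k"] k
        by (subst nn_integral_cmult) (auto simp: S_def[symmetric] ennreal_mult'[symmetric] exp_add[symmetric])
      also have "\<dots> = (\<integral>\<^sup>+\<omega>. ennreal (exp (h * s k (restrict (\<lambda>i. X i \<omega>) {..<k}) - a k)) * g (X k \<omega>) \<partial>M)"
        by (auto simp: s_S S_Suc g_def ennreal_mult'[symmetric] exp_add[symmetric] algebra_simps intro!: nn_integral_cong)
      also have "\<dots> = (\<integral>\<^sup>+\<omega>. ennreal (exp (h * S k \<omega> - a k)) \<partial>M) * (\<integral>\<^sup>+\<omega>. g (X k \<omega>) \<partial>M)"
        using s[of k] by (subst split[of "\<lambda>x. ennreal (exp (h * s k x - a k))" g]) (auto simp: s_S)
      finally show ?thesis
        by (simp add: 1)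
    qed
    define F where "F x = (if \<exists>j\<le>k. u < s j x then 0 else ennreal (exp (h * s k x - a k)))"
      for x
    have [measurable]: "F \<in> borel_measurable (PiM {..<k} (\<lambda>_. borel))"
      unfolding F_def[abs_def] using s by measurable
    define H where "H \<omega> = (if \<exists>j\<le>k. u < S j \<omega> then ennreal (exp (h * u)) else 0)" for \<omega>
    have [measurable]: "H \<in> borel_measurable M"
      unfolding H_def[abs_def] by measurable
    have F_S: "F (restrict (\<lambda>i. X i \<omega>) {..<k})
        = (if \<exists>j\<le>k. u < S j \<omega> then 0 else ennreal (exp (h * S k \<omega> - a k)))" for \<omega>
      by (auto simp: F_def s_S)
    have [measurable]: "(\<lambda>\<omega>. F (restrict (\<lambda>i. X i \<omega>) {..<k})) \<in> borel_measurable M"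
      unfolding F_S by measurable
    have V_le: "V (Suc k) \<omega> \<le> H \<omega> + F (restrict (\<lambda>i. X i \<omega>) {..<k}) * g (X k \<omega>)" for \<omega>
    proof (cases "\<exists>j\<le>k. u < S j \<omega>")
      case True
      then show ?thesis by (auto simp: V_def H_def)
    next
      case False
      have "F (restrict (\<lambda>i. X i \<omega>) {..<k}) * g (X k \<omega>)
          = ennreal (exp (h * S (Suc k) \<omega> - a (Suc k)))"
        using False
        by (simp add: F_S g_def S_Suc ennreal_mult'[symmetric] exp_add[symmetric] algebra_simps)
      moreover have "V (Suc k) \<omega> \<le> ennreal (exp (h * S (Suc k) \<omega> - a (Suc k)))"
      proof (cases "u < S (Suc k) \<omega>")
        case True
        \<comment> \<open>On a passage exactly at \<open>Suc k\<close>, nonpositivity of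
          \<open>a\<close> puts the martingale above the level at which \<open>V\<close> is
          frozen.\<close>
        then have "h * u \<le> h * S (Suc k) \<omega> - a (Suc k)"
          using nonpos[OF Suc.prems] mult_left_mono[of u "S (Suc k) \<omega>" h] \<open>0 \<le> h\<close> by simp
        with True show ?thesis
          by (auto simp: V_def intro!: ennreal_leI)
      next
        case notless: False
        with False have "\<not> (\<exists>j\<le>Suc k. u < S j \<omega>)"
          by (metis le_Suc_eq)
        then show ?thesis unfolding V_def if_not_P[OF \<open>\<not> (\<exists>j\<le>Suc k. u < S j \<omega>)\<close>] by simp
      qed
      ultimately show ?thesis
        using False by (auto simp: H_def)
    qed
    have "(\<integral>\<^sup>+\<omega>. V (Suc k) \<omega> \<partial>M)
        \<le> (\<integral>\<^sup>+\<omega>. H \<omega> + F (restrict (\<lambda>i. X i \<omega>) {..<k}) * g (X k \<omega>) \<partial>M)"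
      by (intro nn_integral_mono V_le)
    \<comment> \<open>\<open>F\<close> sees only the past, so the independent factor
      \<open>g\<close> integrates out to 1.\<close>
    also have "\<dots> = (\<integral>\<^sup>+\<omega>. H \<omega> \<partial>M) + (\<integral>\<^sup>+\<omega>. F (restrict (\<lambda>i. X i \<omega>) {..<k}) \<partial>M)"
      by (subst nn_integral_add) (auto simp: split g_int)
    also have "\<dots> = (\<integral>\<^sup>+\<omega>. V k \<omega> \<partial>M)"
      by (subst nn_integral_add[symmetric])
        (auto simp: V_def H_def F_S intro!: nn_integral_cong)
    also have "\<dots> \<le> 1" using Suc by simp
    finally show ?case .
  qed
  then have V: "(\<integral>\<^sup>+\<omega>. V n \<omega> \<partial>M) \<le> 1" by simp
  let ?E = "{\<omega>\<in>space M. \<exists>k\<le>n. u < S k \<omega>}"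
  \<comment> \<open>Markov's inequality: \<open>V n\<close> equals \<open>exp (h * u)\<close> on the
    passage event.\<close>
  have "ennreal (exp (h * u)) * emeasure M ?E = (\<integral>\<^sup>+\<omega>. ennreal (exp (h * u)) * indicator ?E \<omega> \<partial>M)"
    by (subst nn_integral_cmult_indicator) measurable
  also have "\<dots> \<le> (\<integral>\<^sup>+\<omega>. V n \<omega> \<partial>M)"
    by (intro nn_integral_mono) (auto simp: V_def indicator_def)
  also note V
  finally have *: "ennreal (exp (h * u)) * emeasure M ?E \<le> 1" .
  have "emeasure M ?E = ennreal (exp (- (h * u))) * (ennreal (exp (h * u)) * emeasure M ?E)"
    by (simp add: mult.assoc[symmetric] ennreal_mult'[symmetric] exp_add[symmetric])
  also have "\<dots> \<le> ennreal (exp (- (h * u)))"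
    using mult_left_mono[OF *, of "ennreal (exp (- (h * u)))"] by simp
  finally show ?thesis by (simp add: S_def)
qed

text \<open>Sorting the times and including 0 turns \<open>Y\<close> at these times into partial
  sums of independent increments, because \<open>Y\<close> vanishes at 0.\<close>

lemma (in prob_space) maximal_inequality_finite:
  fixes Y :: "real \<Rightarrow> 'a \<Rightarrow> real"
  assumes incr: "independent_increments M Y"
    and Y_0: "\<And>\<omega>. \<omega> \<in> space M \<Longrightarrow> Y 0 \<omega> = 0"
    and "0 \<le> h"
    and mgf: "\<And>t. 0 \<le> t \<Longrightarrow> (\<integral>\<^sup>+\<omega>. ennreal (exp (h * Y t \<omega>)) \<partial>M) = ennreal (exp (a t))"
    and nonpos: "\<And>t. 0 \<le> t \<Longrightarrow> a t \<le> 0"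
    and "finite F" "F \<subseteq> {0..}"
  shows "emeasure M {\<omega>\<in>space M. \<exists>t\<in>F. u < Y t \<omega>} \<le> ennreal (exp (- (h * u)))"
proof -
  define xs where "xs = sorted_list_of_set (insert 0 F)"
  \<comment> \<open>\<open>n\<close> counts the increments, one fewer than the times
    \<open>t 0\<close>, ..., \<open>t n\<close>.\<close>
  define n where "n = length xs - 1"
  define t where "t i = xs ! i" for i
  have xs: "set xs = insert 0 F" "sorted_wrt (<) xs"
    using \<open>finite F\<close> by (simp_all only: xs_def set_sorted_list_of_set finite_insert strict_sorted_list_of_set)
  have len: "length xs = Suc n"
    using xs(1) by (cases xs) (auto simp: n_def)
  have t_nonneg: "0 \<le> t k" if "k \<le> n" for k
  proof -
    have "t k \<in> set xs" using that len by (auto simp: t_def)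
    then show ?thesis using xs(1) \<open>F \<subseteq> {0..}\<close> by auto
  qed
  have t_less: "t i < t j" if "i < j" "j \<le> n" for i j
    using xs(2) that len by (auto simp: t_def sorted_wrt_iff_nth_less)
  have t_0: "t 0 = 0"
  proof -
    obtain j where j: "j < length xs" "xs ! j = 0"
      using xs(1) by (metis in_set_conv_nth insertI1)
    \<comment> \<open>If 0 stood at a positive position, \<open>t 0\<close> would be
      negative.\<close>
    with t_less[of 0 j] t_nonneg[of 0] len show ?thesis
      by (cases "j = 0") (auto simp: t_def)
  qed
  define X where "X i \<omega> = Y (t (Suc i)) \<omega> - Y (t i) \<omega>" for i \<omega>
  have indep: "indep_vars (\<lambda>_. borel) X {..<n}"
    using incr t_nonneg[of 0] t_less unfolding independent_increments_def X_def[abs_def]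
    by (auto simp: Suc_le_eq)
  have sum_X: "(\<Sum>i<k. X i \<omega>) = Y (t k) \<omega>" if "\<omega> \<in> space M" for k \<omega>
    using Y_0[OF that] sum_lessThan_telescope[of "\<lambda>i. Y (t i) \<omega>" k] by (simp add: X_def t_0)
  have "emeasure M {\<omega>\<in>space M. \<exists>k\<le>n. u < (\<Sum>i<k. X i \<omega>)} \<le> ennreal (exp (- (h * u)))"
  proof (rule maximal_inequality_indep_sums[where a = "\<lambda>k. a (t k)", OF indep \<open>0 \<le> h\<close>])
    fix k assume "k \<le> n"
    then show "a (t k) \<le> 0" by (intro nonpos t_nonneg)
    show "(\<integral>\<^sup>+\<omega>. ennreal (exp (h * (\<Sum>i<k. X i \<omega>))) \<partial>M) = ennreal (exp (a (t k)))"
      unfolding mgf[OF t_nonneg[OF \<open>k \<le> n\<close>], symmetric]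
      by (intro nn_integral_cong) (simp add: sum_X)
  qed
  moreover have "{\<omega>\<in>space M. \<exists>t\<in>F. u < Y t \<omega>} \<subseteq> {\<omega>\<in>space M. \<exists>k\<le>n. u < (\<Sum>i<k. X i \<omega>)}"
  proof safe
    fix \<omega> s assume "\<omega> \<in> space M" "s \<in> F" "u < Y s \<omega>"
    moreover from \<open>s \<in> F\<close> obtain k where "k \<le> n" "t k = s"
      using xs(1) len by (metis in_set_conv_nth insertI2 less_Suc_eq_le t_def)
    ultimately show "\<exists>k\<le>n. u < (\<Sum>i<k. X i \<omega>)"
      by (auto simp: sum_X)
  qed
  moreover have "{\<omega>\<in>space M. \<exists>k\<le>n. u < (\<Sum>i<k. X i \<omega>)} \<in> sets M"
  proof -
    have [measurable]: "X i \<in> borel_measurable M" if "i < n" for i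
      using indep that by (auto simp: indep_vars_def)
    have "(\<lambda>\<omega>. \<Sum>i<k. X i \<omega>) \<in> borel_measurable M" if "k \<le> n" for k
      using that by (intro borel_measurable_sum) auto
    then show ?thesis by measurable
  qed
  ultimately show ?thesis
    by (meson emeasure_mono order_trans)
qed

text \<open>The finite bound does not depend on the set of times, so it survives exhaustion by
  finite sets and continuity from below.\<close>

lemma (in prob_space) maximal_inequality_countable:
  fixes Y :: "real \<Rightarrow> 'a \<Rightarrow> real"
  assumes incr: "independent_increments M Y"
    and Y_0: "\<And>\<omega>. \<omega> \<in> space M \<Longrightarrow> Y 0 \<omega> = 0"
    and Y_meas: "\<And>t. 0 \<le> t \<Longrightarrow> Y t \<in> borel_measurable M"
    and "0 \<le> h"
    and mgf: "\<And>t. 0 \<le> t \<Longrightarrow> (\<integral>\<^sup>+\<omega>. ennreal (exp (h * Y t \<omega>)) \<partial>M) = ennreal (exp (a t))"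
    and nonpos: "\<And>t. 0 \<le> t \<Longrightarrow> a t \<le> 0"
    and "countable D" "D \<subseteq> {0..}"
  shows "emeasure M {\<omega>\<in>space M. \<exists>t\<in>D. u < Y t \<omega>} \<le> ennreal (exp (- (h * u)))"
proof (cases "D = {}")
  case False
  define F where "F n = from_nat_into D ` {..<n}" for n
  have F_sub: "F n \<subseteq> D" for n
    using from_nat_into[OF False] by (auto simp: F_def)
  have D_eq: "D = (\<Union>n. F n)"
    using F_sub from_nat_into_surj[OF \<open>countable D\<close>] by (fastforce simp: F_def)
  define A where "A n = {\<omega>\<in>space M. \<exists>t\<in>F n. u < Y t \<omega>}" for n
  have "A n \<in> sets M" for n
  proof -
    have [measurable]: "Y t \<in> borel_measurable M" if "t \<in> F n" for t
      using F_sub that \<open>D \<subseteq> {0..}\<close> by (intro Y_meas) auto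
    have "finite (F n)" by (simp add: F_def)
    then show ?thesis unfolding A_def by measurable
  qed
  moreover have "incseq A"
    by (fastforce simp: incseq_def A_def F_def)
  ultimately have "emeasure M (\<Union>n. A n) = (SUP n. emeasure M (A n))"
    by (intro SUP_emeasure_incseq[symmetric]) auto
  also have "\<dots> \<le> ennreal (exp (- (h * u)))"
    unfolding A_def
    using F_sub \<open>D \<subseteq> {0..}\<close>
    by (intro SUP_least maximal_inequality_finite[where a = a] assms) (auto simp: F_def)
  also have "(\<Union>n. A n) = {\<omega>\<in>space M. \<exists>t\<in>D. u < Y t \<omega>}"
    by (auto simp: A_def D_eq)
  finally show ?thesis .
qed simp

section \<open>Initial value of the discounted loss and extended exponentials\<close>

lemma stieltjes_integral_refl: "stieltjes_integral f F a a = 0"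
proof -
  have const: "(\<lambda>x. if x < a then F a else if a \<le> x then F a else Inf (F ` {x<..a})) = (\<lambda>_. F a)"
    by auto
  have "emeasure (stieltjes_measure F a a) {a..a} = 0"
    unfolding stieltjes_measure_def const by (subst emeasure_interval_measure_Icc) auto
  then have "AE x in stieltjes_measure F a a. x \<notin> {a..a}"
    by (intro AE_not_in) (auto simp: null_sets_def stieltjes_measure_def)
  then show ?thesis
    unfolding stieltjes_integral_def set_lebesgue_integral_def
    by (intro integral_eq_zero_AE) (auto elim!: eventually_mono)
qed

lemma discounted_loss_0: "discounted_loss p q r 0 \<omega> = 0"
  by (simp add: discounted_loss_def bv_stieltjes_integral_def stieltjes_integral_refl)

text \<open>Reduces the final estimate to a comparison of exponents in \<open>ereal\<close>, where
  an infinite adjustment coefficient needs no separate treatment.\<close>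

lemma ennreal_le_ereal_exp:
  assumes "0 < x" "ereal (ln x) \<le> y"
  shows "ennreal x \<le> ereal_exp y"
proof (cases y)
  case (real v)
  then have "exp (ln x) \<le> exp v" using assms(2) by simp
  then show ?thesis using real assms(1) by (simp add: ereal_exp_def ennreal_leI)
qed (use assms(2) in \<open>simp_all add: ereal_exp_def\<close>)

section \<open>From first passage to ruin\<close>

theorem corollary2p2:
  fixes M :: "'a measure"
    and N :: "real \<Rightarrow> 'a \<Rightarrow> nat"
    and \<Lambda> p r :: "real \<Rightarrow> real"
    and Z q R :: "real \<Rightarrow> 'a \<Rightarrow> real"
    and \<alpha> \<beta> :: "real \<Rightarrow> real \<Rightarrow> 'a \<Rightarrow> real"
    and u :: real
  assumes "0 \<le> u"
    and "risk_model M N \<Lambda> Z p q r \<alpha> \<beta> R u"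
    and "\<And>t \<omega>. 0 < t \<Longrightarrow> \<omega> \<in> space M \<Longrightarrow>
           exp (- r t) * R t \<omega> \<ge> u - discounted_loss p q r t \<omega>"
    and "\<And>t. 0 \<le> t \<Longrightarrow> discounted_loss p q r t \<in> borel_measurable M"
    and "separable_process M (discounted_loss p q r)"
    and "independent_increments M (discounted_loss p q r)"
    and "\<And>h t. 0 \<le> h \<Longrightarrow> 0 \<le> t \<Longrightarrow>
           (\<integral>\<^sup>+ \<omega>. ennreal (exp (h * discounted_loss p q r t \<omega>)) \<partial>M)
             = ereal_exp (cumulant M \<Lambda> Z p r h t)"
  shows "ennreal (ruin_probability M R)
           \<le> ereal_exp (- (adjustment_coefficient M \<Lambda> Z p r * ereal u))"
proof -
  interpret risk_model M N \<Lambda> Z p q r \<alpha> \<beta> R u by fact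
  define Y where "Y = discounted_loss p q r"
  define P where "P = ruin_probability M R"
  let ?E = "{\<omega>\<in>space M. (INF t\<in>{0..}. ereal (R t \<omega>)) < 0}"
  let ?L = "adjustment_coefficient M \<Lambda> Z p r"
  obtain D \<Theta> where D: "countable D" "D \<subseteq> {0..}" and \<Theta>: "\<Theta> \<in> null_sets M"
    and sep: "\<And>I A \<omega>. open I \<Longrightarrow> is_interval I \<Longrightarrow> closed A \<Longrightarrow> is_interval A \<Longrightarrow>
      \<omega> \<in> space M - \<Theta> \<Longrightarrow> (\<forall>t\<in>I \<inter> {0..}. Y t \<omega> \<in> A) \<longleftrightarrow> (\<forall>t\<in>I \<inter> D. Y t \<omega> \<in> A)"
    using assms(5) unfolding separable_process_def Y_def by metis
  let ?B = "{\<omega>\<in>space M. \<exists>t\<in>D. u < Y t \<omega>}"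
  have Y_meas: "Y t \<in> borel_measurable M" if "0 \<le> t" for t
    using assms(4) that by (simp add: Y_def)
  have B_meas: "?B \<in> sets M"
  proof -
    have [measurable]: "Y t \<in> borel_measurable M" if "t \<in> D" for t
      using D that by (intro Y_meas) auto
    show ?thesis using \<open>countable D\<close> by measurable
  qed
  \<comment> \<open>Ruin happens at some \<open>t > 0\<close>, as the initial reserve is
    nonnegative; there the pathwise bound gives \<open>Y t > u\<close>. Up to the null set, the
    passage is then visible on \<open>D\<close>.\<close>
  have ruin_sub: "?E \<subseteq> ?B \<union> \<Theta>"
  proof (intro subsetI, rule ccontr)
    fix \<omega> assume "\<omega> \<in> ?E" and not: "\<omega> \<notin> ?B \<union> \<Theta>"
    then obtain t where t: "0 \<le> t" "R t \<omega> < 0" and \<omega>: "\<omega> \<in> space M"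
      by (auto simp: INF_less_iff)
    with reserve_zero[OF \<omega>] \<open>0 \<le> u\<close> have "0 < t"
      by (cases "t = 0") auto
    then have "u - Y t \<omega> \<le> exp (- r t) * R t \<omega>"
      using assms(3) \<omega> by (simp add: Y_def)
    also have "\<dots> < 0"
      using t(2) by (simp add: mult_pos_neg)
    finally have "u < Y t \<omega>" by simp
    \<comment> \<open>Separability with the whole line as open interval and \<open>{..u}\<close> as
      closed interval carries the bound from \<open>D\<close> to all times.\<close>
    moreover have "\<forall>t\<in>UNIV \<inter> {0..}. Y t \<omega> \<in> {..u}"
      using not \<omega> by (subst sep) (auto simp: not_less is_interval_univ is_interval_ic)
    ultimately show False using t(1) by (auto dest!: bspec[where x = t])
  qed
  have bound: "P \<le> exp (- (h * u))"
    if h: "0 \<le> h" "(SUP t\<in>{0..}. cumulant M \<Lambda> Z p r h t) \<le> 0" for h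
  proof -
    have le: "cumulant M \<Lambda> Z p r h t \<le> 0" if "0 \<le> t" for t
      using h(2) that by (auto simp: SUP_le_iff)
    \<comment> \<open>The premium term is finite and the claim term nonnegative. With the upper
      bound 0 the cumulant is therefore a real number.\<close>
    have "cumulant M \<Lambda> Z p r h t \<noteq> - \<infinity>" for t
      by (simp add: cumulant_def)
    with le have fin: "\<bar>cumulant M \<Lambda> Z p r h t\<bar> \<noteq> \<infinity>" if "0 \<le> t" for t
      using that by fastforce
    define a where "a t = real_of_ereal (cumulant M \<Lambda> Z p r h t)" for t
    have a_le: "a t \<le> 0" if "0 \<le> t" for t
      using le[OF that] by (simp add: a_def real_of_ereal_le_0)
    have mgf: "(\<integral>\<^sup>+\<omega>. ennreal (exp (h * Y t \<omega>)) \<partial>M) = ennreal (exp (a t))" if "0 \<le> t" for t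
      using assms(7)[OF h(1) that] fin[OF that] by (auto simp: Y_def a_def ereal_exp_def)
    have "ennreal P = emeasure M ?E"
      by (simp add: P_def ruin_probability_def emeasure_eq_measure)
    also have "\<dots> \<le> emeasure M (?B \<union> \<Theta>)"
      using B_meas \<Theta> by (intro emeasure_mono ruin_sub) auto
    also have "\<dots> = emeasure M ?B"
      by (intro emeasure_Un_null_set B_meas \<Theta>)
    also have "\<dots> \<le> ennreal (exp (- (h * u)))"
      by (rule maximal_inequality_countable[where a = a])
        (use assms(6) h(1) mgf a_le Y_meas D in \<open>auto simp: Y_def discounted_loss_0\<close>)
    finally show ?thesis by simp
  qed
  have P: "0 \<le> P" "P \<le> 1"
    by (simp_all add: P_def ruin_probability_def)
  show ?thesis
  \<comment> \<open>The remaining case \<open>P > 0\<close> allows logarithms, and the claim becomes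
    \<open>?L * ereal u \<le> - ln P\<close>.\<close>
  proof (cases "P = 0")
    case False
    with P have pos: "0 < P" by simp
    have "?L * ereal u \<le> ereal (- ln P)"
    proof (cases "u = 0")
      case True
      \<comment> \<open>The product is 0 even for infinite \<open>?L\<close>, and
        \<open>- ln P\<close> is nonnegative because \<open>P \<le> 1\<close>.\<close>
      then show ?thesis using P pos by (simp add: zero_ereal_def[symmetric])
    next
      case False
      with \<open>0 \<le> u\<close> have u: "0 < u" by simp
      \<comment> \<open>Every admissible \<open>h\<close> obeys this bound, hence so does the
        supremum, attained or not. In particular \<open>?L\<close> is finite here: for
        \<open>u > 0\<close> an infinite coefficient is possible only when
        \<open>P = 0\<close>.\<close>
      have "?L \<le> ereal (- ln P / u)"
        unfolding adjustment_coefficient_def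
      proof (intro Sup_least, clarsimp)
        fix h assume "0 \<le> h" "(SUP t\<in>{0..}. cumulant M \<Lambda> Z p r h t) \<le> 0"
        then have "ln P \<le> - (h * u)"
          using bound pos by (metis ln_exp ln_le_cancel_iff exp_gt_zero)
        then show "h \<le> - (ln P / u)" using u by (simp add: field_simps)
      qed
      then have "?L * ereal u \<le> ereal (- ln P / u) * ereal u"
        using u by (intro ereal_mult_right_mono) auto
      then show ?thesis using u by simp
    qed
    then have "ereal (ln P) \<le> - (?L * ereal u)"
      by (metis ereal_uminus_le_reorder uminus_ereal.simps(1) ereal_uminus_uminus)
    then show ?thesis
      using ennreal_le_ereal_exp[OF pos] by (simp add: P_def)
  qed (simp add: P_def[symmetric])
qed

end
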